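(* In the setting described in the context (drift $b$ on the torus with two stable and two unstable equilibria and $V(\mathfrak m_1)=V(\mathfrak m_2)=0$), the pre-factor $F_\epsilon$ defined by $m_\epsilon(\theta)=F_\epsilon(\theta)\,e^{-V(\theta)/\epsilon}$ satisfies: (1) (Pre-factor on valleys) for all $x\in\mathscr V_i$, $i=1,2$, $$F_\epsilon(x)=[1+o(1)]\,\frac{\omega(\mathfrak M_{i+1})}{Z\sqrt{\epsilon}},$$ where $o(1)\to0$ as $\epsilon\to0$ uniformly on $\mathscr V_1\cup\mathscr V_2$. (2) (Pre-factor on saddle intervals) for all $x\in\Sigma_1\cup\Sigma_2$, $$F_\epsilon(x)=[1+o(1)]\,\frac{1}{Z\,b(x)},$$ where $o(1)\to 0$ as $\epsilon\to0$ for every $x\in\Sigma_1\cup\Sigma_2$.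
   Context: $\mathbb T=[0,1)$ is the one-dimensional torus; functions on $\mathbb T$ are identified with $1$-periodic functions on $\mathbb R$. The drift $b:\mathbb T\to\mathbb R$ is smooth, $\{\theta\in\mathbb T:b(\theta)=0\}$ consists of exactly four points (none equal to $0$), $b'\neq 0$ at each of them, and $B:=\int_{\mathbb T}b(\theta)\,d\theta>0$. For $\epsilon>0$ consider the diffusion $dX_\epsilon(t)=b(X_\epsilon(t))dt+\sqrt{2\epsilon}\,dW_t$ on $\mathbb T$. Let $S(x)=-\int_0^x b(y)\,dy$, $x\in\mathbb R$, so that $S(x+1)=S(x)-B$. For $x\in\mathbb R$, $z(x)=z_x$ is the largest point of $[x,\infty)$ at which the maximum of $\{S(y):y\ge x\}$ is attained, and $\widehat V(x)=S(x)-S(z_x)$, a $1$-periodic function (the quasi-potential). The stationary density of $X_\epsilon$ is $m_\epsilon(x)=\pi_\epsilon(x)/c(\epsilon)$, where $\pi_\epsilon(x)=\int_x^{x+1}e^{[S(y)-S(x)]/\epsilon}dy$ ($1$-periodic) and $c(\epsilon)=\int_0^1\pi_\epsilon(x)\,dx$. The function $S$ has in $[0,1)$ two local maxima $\mathfrak M_1,\mathfrak M_2$ and two local minima $\mathfrak m_1,\mathfrak m_2$, with $0<\mathfrak M_1<\mathfrak m_1<\mathfrak M_2<\mathfrak m_2<1$. Put $\mathfrak M_3=1+\mathfrak M_1$ and assume $S(\mathfrak M_1)>S(\mathfrak M_2)>S(\mathfrak M_3)$. For $i=1,2$ let $\ell_i=\inf\{x>\mathfrak M_i:S(x)=S(\mathfrak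 M_{i+1})\}$, $\Sigma_i=(\mathfrak M_i,\ell_i)$ (saddle intervals), $\mathscr V_i=(\ell_i,\mathfrak M_{i+1})$ (valleys), viewed also as subsets of $\mathbb T$. Assume $\widehat V(\mathfrak m_1)=\widehat V(\mathfrak m_2)=-H$, and set $V=\widehat V+H$. Weights: $\sigma(\mathfrak m_i)=\sqrt{2\pi/(-b'(\mathfrak m_i))}$, $\omega(\mathfrak M_i)=\sqrt{2\pi/b'(\mathfrak M_i)}$, $Z=\sum_{j=1}^2\sigma(\mathfrak m_j)\,\omega(\mathfrak M_{j+1})$.
   Formalization: In (1), o(1) is uniform on {x in V_i : x < M_{i+1} - δ}, i=1,2, for every δ>0, not on all of V_1 ∪ V_2: as x → M_{i+1} the continuous F_ε tends to a value asymptotic to half the claimed one, so uniformity up to M_{i+1} fails for every such drift. *)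

theory Defs
  imports "HOL-Analysis.Analysis"
begin

text \<open>Functions on the torus are 1-periodic functions on the reals.\<close>

definition smooth :: "(real \<Rightarrow> real) \<Rightarrow> bool" where
  "smooth f \<longleftrightarrow> (\<forall>k x. ((deriv ^^ k) f) differentiable (at x))"

definition loc_max :: "(real \<Rightarrow> real) \<Rightarrow> real \<Rightarrow> bool" where
  "loc_max f x \<longleftrightarrow> (\<forall>\<^sub>F y in nhds x. f y \<le> f x)"

definition loc_min :: "(real \<Rightarrow> real) \<Rightarrow> real \<Rightarrow> bool" where
  "loc_min f x \<longleftrightarrow> (\<forall>\<^sub>F y in nhds x. f x \<le> f y)"

text \<open>The interval integral is oriented, so this is also correct for negative \<open>x\<close>.\<close>

definition S :: "(real \<Rightarrow> real) \<Rightarrow> real \<Rightarrow> real" where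
  "S b x = - (LBINT y=0..x. b y)"

definition zmax :: "(real \<Rightarrow> real) \<Rightarrow> real \<Rightarrow> real" where
  "zmax b x = (GREATEST z. x \<le> z \<and> (\<forall>y\<ge>x. S b y \<le> S b z))"

definition Vhat :: "(real \<Rightarrow> real) \<Rightarrow> real \<Rightarrow> real" where
  "Vhat b x = S b x - S b (zmax b x)"

definition quasi_potential :: "(real \<Rightarrow> real) \<Rightarrow> real \<Rightarrow> real \<Rightarrow> real" where
  "quasi_potential b H x = Vhat b x + H"

definition pi_eps :: "(real \<Rightarrow> real) \<Rightarrow> real \<Rightarrow> real \<Rightarrow> real" where
  "pi_eps b \<epsilon> x = integral {x..x+1} (\<lambda>y. exp ((S b y - S b x) / \<epsilon>))"

definition c_eps :: "(real \<Rightarrow> real) \<Rightarrow> real \<Rightarrow> real" where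
  "c_eps b \<epsilon> = integral {0..1} (pi_eps b \<epsilon>)"

text \<open>The stationary density of \<open>dX = b(X) dt + sqrt (2 \<epsilon>) dW\<close> on the torus, through its explicit
  formula.\<close>

definition m_eps :: "(real \<Rightarrow> real) \<Rightarrow> real \<Rightarrow> real \<Rightarrow> real" where
  "m_eps b \<epsilon> x = pi_eps b \<epsilon> x / c_eps b \<epsilon>"

text \<open>The solution \<open>F\<close> of \<open>m_eps b \<epsilon> x = F * exp (- quasi_potential b H x / \<epsilon>)\<close>.\<close>

definition prefactor :: "(real \<Rightarrow> real) \<Rightarrow> real \<Rightarrow> real \<Rightarrow> real \<Rightarrow> real" where
  "prefactor b H \<epsilon> x = m_eps b \<epsilon> x * exp (quasi_potential b H x / \<epsilon>)"

text \<open>Below, \<open>M 1\<close>, \<open>M 2\<close> are the local maxima of \<open>S b\<close> in \<open>[0,1)\<close>, \<open>M 3 = 1 + M 1\<close>, and \<open>m 1\<close>,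
  \<open>m 2\<close> are the local minima. Saddle intervals and valleys are represented by their lifts to the reals;
  \<open>valley b M 2\<close> extends beyond 1. The pre-factor asymptotics on a valley cannot be uniform up to
  the right end point \<open>M (i + 1)\<close>: there \<open>pi_eps\<close> only sees half of the Gaussian peak, so that the
  continuous function \<open>prefactor b H \<epsilon>\<close> takes asymptotically half of the claimed value. Hence uniformity
  is stated off arbitrarily small left neighbourhoods of \<open>M (i + 1)\<close>.\<close>

definition ell :: "(real \<Rightarrow> real) \<Rightarrow> (nat \<Rightarrow> real) \<Rightarrow> nat \<Rightarrow> real" where
  "ell b M i = Inf {x. x > M i \<and> S b x = S b (M (i + 1))}"

definition saddle_interval :: "(real \<Rightarrow> real) \<Rightarrow> (nat \<Rightarrow> real) \<Rightarrow> nat \<Rightarrow> real set" where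
  "saddle_interval b M i = {M i <..< ell b M i}"

definition valley :: "(real \<Rightarrow> real) \<Rightarrow> (nat \<Rightarrow> real) \<Rightarrow> nat \<Rightarrow> real set" where
  "valley b M i = {ell b M i <..< M (i + 1)}"

definition sigma_weight :: "(real \<Rightarrow> real) \<Rightarrow> real \<Rightarrow> real" where
  "sigma_weight b x = sqrt (2 * pi / (- deriv b x))"

definition omega_weight :: "(real \<Rightarrow> real) \<Rightarrow> real \<Rightarrow> real" where
  "omega_weight b x = sqrt (2 * pi / deriv b x)"

definition Z_weight :: "(real \<Rightarrow> real) \<Rightarrow> (nat \<Rightarrow> real) \<Rightarrow> (nat \<Rightarrow> real) \<Rightarrow> real" where
  "Z_weight b M m = (\<Sum>j\<in>{1, 2}. sigma_weight b (m j) * omega_weight b (M (j + 1)))"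

end

theory Submission
  imports Defs "HOL-Probability.Distributions" "HOL-Real_Asymp.Real_Asymp"
begin

text \<open>
  Since \<open>S' = - b\<close>, the density \<open>m_eps\<close> is a ratio of integrals of \<open>exp (S / \<epsilon>)\<close>, and the theorem is an
  application of Laplace's method to numerator and denominator.

  Numerator. The integral \<open>pi_eps b \<epsilon> x\<close> is governed by the maximum of \<open>S\<close> on \<open>{x..x+1}\<close>. For \<open>x\<close> in the
  saddle interval this maximum is the end point \<open>x\<close>, where \<open>S\<close> has slope \<open>- b x\<close>: the integral is
  \<open>\<epsilon> / b x\<close> to leading order. For \<open>x\<close> in the valley it is the next local maximum, an interior point with
  a Gaussian peak: the integral is \<open>exp (- Vhat b x / \<epsilon>) * omega_weight * sqrt \<epsilon>\<close>. Uniformity on the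
  valley comes from monotonicity in the domain of integration: the normalised integrand does not depend
  on \<open>x\<close>, so the integral over \<open>{x..x+1}\<close> lies between those over two fixed intervals around the peak,
  and these two have the same asymptotics (\<open>peak_asymptotics\<close>, \<open>peak_asymptotics_interior\<close>). The smaller
  one has the peak in its interior only if \<open>x\<close> keeps a fixed distance from the peak, hence the
  restriction to such \<open>x\<close>. The larger interval starts at the left end of the valley, where \<open>S\<close> is as high as at the peak; there
  the slope is nonzero, so this end contributes only order \<open>\<epsilon>\<close>, against \<open>sqrt \<epsilon>\<close> from the peak.

  Denominator. By periodicity \<open>c_eps\<close> is the integral of \<open>pi_eps\<close> over the two pieces between consecutive
  local maxima of \<open>S\<close>. On a saddle interval \<open>pi_eps \<le> 1\<close>, which is negligible against \<open>exp (H / \<epsilon>)\<close>.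
  On a valley the bounds above reduce the double integral to the Gaussian peak at the
  maximum times a Gaussian integral at the minimum (\<open>mass_asymptotics\<close>). Hence to leading order each piece is
  \<open>\<epsilon> * exp (H / \<epsilon>) * sigma_weight * omega_weight\<close>, with the same \<open>H\<close> as the two wells are equally deep,
  and \<open>c_eps\<close> is \<open>\<epsilon> * exp (H / \<epsilon>) * Z\<close>. The quotient gives both claims
  (\<open>prefactor_valley\<close>, \<open>prefactor_saddle\<close>).

  These estimates concern one well at a time and are carried out in the locale \<open>potential_well\<close>;
  the theorem instantiates it for both wells, reading off the signs of \<open>b\<close> from the types of the critical
  points of \<open>S\<close> and the fact that \<open>b\<close> has no further zeros.
\<close>

section \<open>Laplace's method\<close>

text \<open>The quotient \<open>g y / \<bar>y - p\<bar> ^ q\<close> extends continuously and positively to \<open>p\<close>, hence attains a positive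
  minimum. This bound supplies the integrable majorant in Laplace's method.\<close>

lemma power_coercive_on_compact:
  fixes g :: "real \<Rightarrow> real"
  assumes "compact A" "continuous_on A g" "g p = 0" "0 < q"
    and pos: "\<And>y. y \<in> A \<Longrightarrow> y \<noteq> p \<Longrightarrow> 0 < g y"
    and lim: "((\<lambda>y. g y / \<bar>y - p\<bar> ^ q) \<longlongrightarrow> k) (at p within A)" and "0 < k"
  obtains c where "0 < c" "\<And>y. y \<in> A \<Longrightarrow> c * \<bar>y - p\<bar> ^ q \<le> g y"
proof (cases "A = {}")
  case True
  then show ?thesis using that[of 1] by auto
next
  case False
  define \<phi> where "\<phi> y = (if y = p then k else g y / \<bar>y - p\<bar> ^ q)" for y
  have "continuous (at x within A) \<phi>" if "x \<in> A" for x
  proof (cases "x = p")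
    case True
    have "(\<phi> \<longlongrightarrow> k) (at p within A)"
      by (rule Lim_transform_eventually[OF lim]) (auto simp: \<phi>_def eventually_at_filter)
    then show ?thesis by (simp add: True continuous_within \<phi>_def)
  next
    case False
    have "continuous (at x within A) (\<lambda>y. g y / \<bar>y - p\<bar> ^ q)"
      using assms(2) that False by (intro continuous_intros) (auto simp: continuous_on_eq_continuous_within)
    then have "((\<lambda>y. g y / \<bar>y - p\<bar> ^ q) \<longlongrightarrow> \<phi> x) (at x within A)"
      using False by (simp add: continuous_within \<phi>_def)
    moreover have "\<forall>\<^sub>F y in at x within A. y \<noteq> p"
      using False by (metis eventually_neq_at_within)
    ultimately have "(\<phi> \<longlongrightarrow> \<phi> x) (at x within A)"
      by (rule Lim_transform_eventually[OF _ eventually_mono]) (auto simp: \<phi>_def)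
    then show ?thesis by (simp add: continuous_within)
  qed
  then have "continuous_on A \<phi>"
    by (simp add: continuous_on_eq_continuous_within)
  then obtain x where x: "x \<in> A" "\<And>y. y \<in> A \<Longrightarrow> \<phi> x \<le> \<phi> y"
    using continuous_attains_inf[OF assms(1) False] by blast
  show ?thesis
  proof (rule that)
    show "0 < \<phi> x" using pos x(1) \<open>0 < k\<close> by (simp add: \<phi>_def)
    show "\<phi> x * \<bar>y - p\<bar> ^ q \<le> g y" if "y \<in> A" for y
    proof (cases "y = p")
      case True
      then show ?thesis using \<open>g p = 0\<close> \<open>0 < q\<close> by (simp add: zero_power)
    next
      case False
      then have "\<phi> x \<le> g y / \<bar>y - p\<bar> ^ q" using x(2)[OF that] by (simp add: \<phi>_def)
      then show ?thesis using False by (simp add: pos_le_divide_eq)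
    qed
  qed
qed

text \<open>Laplace's method at a minimum \<open>p\<close> of order \<open>q\<close> by dominated convergence: after substituting \<open>y = p + h * t\<close>
  with \<open>h ^ q\<close> the small parameter, the integrand converges pointwise to \<open>exp (- (k * \<bar>t\<bar> ^ q))\<close> and is
  dominated by \<open>exp (- (c * \<bar>t\<bar> ^ q))\<close>. The set \<open>D\<close> is the cone of directions from \<open>p\<close> into the interval:
  the whole line if \<open>p\<close> is interior, the half-line if \<open>p\<close> is the left end point.\<close>

lemma laplace_rescaled:
  fixes g :: "real \<Rightarrow> real"
  assumes cont: "continuous_on {a..d} g" and "g p = 0" "0 < q"
    and pos: "\<And>y. y \<in> {a..d} \<Longrightarrow> y \<noteq> p \<Longrightarrow> 0 < g y"
    and lim: "((\<lambda>y. g y / \<bar>y - p\<bar> ^ q) \<longlongrightarrow> k) (at p within {a..d})" and "0 < k"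
    and cone: "\<And>h t. 0 < h \<Longrightarrow> p + h * t \<in> {a..d} \<Longrightarrow> t \<in> D"
    and cone': "\<And>t. t \<in> D \<Longrightarrow> \<forall>\<^sub>F h in at_right 0. p + h * t \<in> {a..d}"
    and int: "\<And>c. 0 < c \<Longrightarrow> set_integrable lborel D (\<lambda>t. exp (- (c * \<bar>t\<bar> ^ q)))"
    and [measurable]: "D \<in> sets borel"
  shows "((\<lambda>h. integral {a..d} (\<lambda>y. exp (- (g y / h ^ q))) / h)
    \<longlongrightarrow> (LINT t:D|lborel. exp (- (k * \<bar>t\<bar> ^ q)))) (at_right 0)"
proof -
  obtain c where c: "0 < c" "\<And>y. y \<in> {a..d} \<Longrightarrow> c * \<bar>y - p\<bar> ^ q \<le> g y"
    using power_coercive_on_compact[OF _ cont \<open>g p = 0\<close> \<open>0 < q\<close> pos lim \<open>0 < k\<close>] by auto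
  define F where "F h t = indicator {a..d} (p + h * t) * exp (- (g (p + h * t) / h ^ q))" for h t
  have meas: "(\<lambda>y. indicator {a..d} y * exp (- (g y / h ^ q))) \<in> borel_measurable lborel" for h
  proof -
    have "continuous_on {a..d} (\<lambda>y. exp (- (g y / h ^ q)))"
      unfolding divide_inverse by (intro continuous_intros cont)
    then show ?thesis
      using borel_measurable_continuous_on_indicator[of "{a..d}" "\<lambda>y. exp (- (g y / h ^ q))"]
      by simp
  qed
  have [measurable]: "F h \<in> borel_measurable lborel" for h
    using measurable_compose[of "\<lambda>t. p + h * t" lborel lborel, OF _ meas[of h]]
    unfolding F_def by simp
  have rescale: "integral {a..d} (\<lambda>y. exp (- (g y / h ^ q))) / h = (LINT t|lborel. F h t)"
    if "0 < h" for h
  proof -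
    have "continuous_on {a..d} (\<lambda>y. exp (- (g y / h ^ q)))"
      unfolding divide_inverse by (intro continuous_intros cont)
    then have "set_integrable lborel {a..d} (\<lambda>y. exp (- (g y / h ^ q)))"
      by (rule borel_integrable_atLeastAtMost')
    then have "integral {a..d} (\<lambda>y. exp (- (g y / h ^ q)))
        = (LINT y|lborel. indicator {a..d} y * exp (- (g y / h ^ q)))"
      by (simp add: set_borel_integral_eq_integral(2)[symmetric] set_lebesgue_integral_def)
    also have "\<dots> = h * (LINT t|lborel. F h t)"
      using lborel_integral_real_affine[of h "\<lambda>y. indicator {a..d} y * exp (- (g y / h ^ q))" p] that
      by (simp add: F_def)
    finally show ?thesis using that by simp
  qed
  have limit: "((\<lambda>h. F h t) \<longlongrightarrow> indicator D t * exp (- (k * \<bar>t\<bar> ^ q))) (at_right 0)" for t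
  proof (cases "t \<in> D")
    case True
    have "((\<lambda>h. g (p + h * t) / h ^ q) \<longlongrightarrow> k * \<bar>t\<bar> ^ q) (at_right 0)"
    proof (cases "t = 0")
      case True
      then show ?thesis using \<open>g p = 0\<close> \<open>0 < q\<close> by (simp add: zero_power)
    next
      case False
      have "filterlim (\<lambda>h. p + h * t) (at p within {a..d}) (at_right 0)"
        unfolding filterlim_at
      proof
        show "\<forall>\<^sub>F h in at_right 0. p + h * t \<in> {a..d} \<and> p + h * t \<noteq> p"
          using cone'[OF \<open>t \<in> D\<close>] eventually_at_right_less[of 0]
          by eventually_elim (use False in auto)
        have "((\<lambda>h. p + h * t) \<longlongrightarrow> p + 0 * t) (at_right 0)" by (intro tendsto_intros)
        then show "((\<lambda>h. p + h * t) \<longlongrightarrow> p) (at_right 0)" by simp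
      qed
      from filterlim_compose[OF lim this]
      have "((\<lambda>h. g (p + h * t) / \<bar>p + h * t - p\<bar> ^ q * \<bar>t\<bar> ^ q) \<longlongrightarrow> k * \<bar>t\<bar> ^ q) (at_right 0)"
        by (intro tendsto_mult_right)
      moreover have "\<forall>\<^sub>F h in at_right 0. g (p + h * t) / \<bar>p + h * t - p\<bar> ^ q * \<bar>t\<bar> ^ q
          = g (p + h * t) / h ^ q"
        using eventually_at_right_less[of 0]
        by eventually_elim (use False in \<open>simp add: abs_mult power_mult_distrib\<close>)
      ultimately show ?thesis by (rule Lim_transform_eventually)
    qed
    then have "((\<lambda>h. exp (- (g (p + h * t) / h ^ q))) \<longlongrightarrow> exp (- (k * \<bar>t\<bar> ^ q))) (at_right 0)"
      by (intro tendsto_intros)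
    moreover have "\<forall>\<^sub>F h in at_right 0. exp (- (g (p + h * t) / h ^ q)) = F h t"
      using cone'[OF True] by eventually_elim (simp add: F_def)
    ultimately show ?thesis
      using True by (simp add: Lim_transform_eventually)
  next
    case False
    have "\<forall>\<^sub>F h in at_right 0. F h t = 0"
      using eventually_at_right_less[of 0]
      by eventually_elim (use False cone in \<open>auto simp: F_def indicator_def\<close>)
    then show ?thesis using False by (simp add: tendsto_eventually)
  qed
  have bound: "norm (F h t) \<le> indicator D t * exp (- (c * \<bar>t\<bar> ^ q))" if "0 < h" for h t
  proof (cases "p + h * t \<in> {a..d}")
    case True
    then have "c * \<bar>t\<bar> ^ q * h ^ q \<le> g (p + h * t)"
      using c(2)[OF True] that by (simp add: abs_mult power_mult_distrib mult_ac)
    then have "c * \<bar>t\<bar> ^ q \<le> g (p + h * t) / h ^ q"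
      using that by (simp add: pos_le_divide_eq)
    then show ?thesis using True cone[OF that True] by (simp add: F_def)
  next
    case False
    then show ?thesis by (simp add: F_def)
  qed
  have "((\<lambda>h. LINT t|lborel. F h t) \<longlongrightarrow> (LINT t:D|lborel. exp (- (k * \<bar>t\<bar> ^ q)))) (at_right 0)"
    unfolding tendsto_at_iff_sequentially comp_def
  proof (intro allI impI)
    fix X :: "nat \<Rightarrow> real"
    assume X: "\<forall>i. X i \<in> {0<..} - {0}" "X \<longlonglongrightarrow> 0"
    have X': "filterlim X (at_right 0) sequentially"
      using X by (auto simp: filterlim_at intro!: always_eventually) (metis less_irrefl)
    show "(\<lambda>n. LINT t|lborel. F (X n) t) \<longlonglongrightarrow> (LINT t:D|lborel. exp (- (k * \<bar>t\<bar> ^ q)))"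
      unfolding set_lebesgue_integral_def real_scaleR_def
    proof (rule integral_dominated_convergence)
      show "integrable lborel (\<lambda>t. indicator D t * exp (- (c * \<bar>t\<bar> ^ q)))"
        using int[OF c(1)] by (simp add: set_integrable_def)
      show "AE t in lborel. (\<lambda>n. F (X n) t) \<longlonglongrightarrow> indicator D t * exp (- (k * \<bar>t\<bar> ^ q))"
        using filterlim_compose[OF limit X'] by simp
      show "AE t in lborel. norm (F (X n) t) \<le> indicator D t * exp (- (c * \<bar>t\<bar> ^ q))" for n
        using bound X(1) by simp
    qed simp_all
  qed
  moreover have "\<forall>\<^sub>F h in at_right 0. (LINT t|lborel. F h t)
      = integral {a..d} (\<lambda>y. exp (- (g y / h ^ q))) / h"
    using eventually_at_right_less[of 0] by eventually_elim (simp add: rescale)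
  ultimately show ?thesis by (rule Lim_transform_eventually)
qed

lemma gaussian_integral:
  fixes k :: real
  assumes "0 < k"
  shows "integrable lborel (\<lambda>t. exp (- (k * t\<^sup>2)))"
    and "(LINT t|lborel. exp (- (k * t\<^sup>2))) = sqrt (pi / k)"
proof -
  define s where "s = 1 / sqrt (2 * k)"
  have s: "0 < s" "s\<^sup>2 = 1 / (2 * k)" using assms by (simp_all add: s_def power_divide)
  have eq: "exp (- (k * t\<^sup>2)) = sqrt (pi / k) * normal_density 0 s t" for t
    using assms by (simp add: normal_density_def s mult.commute real_sqrt_divide)
  show "integrable lborel (\<lambda>t. exp (- (k * t\<^sup>2)))" unfolding eq using s by simp
  show "(LINT t|lborel. exp (- (k * t\<^sup>2))) = sqrt (pi / k)" unfolding eq using s by simp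
qed

lemma exponential_integral:
  fixes k :: real
  assumes "0 < k"
  shows "set_integrable lborel {0..} (\<lambda>t. exp (- (k * \<bar>t\<bar>)))"
    and "(LINT t:{0..}|lborel. exp (- (k * \<bar>t\<bar>))) = 1 / k"
proof -
  have hi: "((\<lambda>t. exp (- k * t)) has_integral 1 / k) {0..}"
    using has_integral_exp_minus_to_infinity[OF assms, of 0] by simp
  then have hi': "((\<lambda>t. exp (- (k * \<bar>t\<bar>))) has_integral 1 / k) {0..}"
    by (rule has_integral_eq[rotated]) auto
  show si: "set_integrable lborel {0..} (\<lambda>t. exp (- (k * \<bar>t\<bar>)))"
  proof -
    have "(\<lambda>t. exp (- (k * \<bar>t\<bar>))) absolutely_integrable_on {0..}"
      using hi' by (intro nonnegative_absolutely_integrable_1) (auto simp: integrable_on_def)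
    then show ?thesis
      unfolding set_integrable_def by (subst (asm) integrable_completion) auto
  qed
  show "(LINT t:{0..}|lborel. exp (- (k * \<bar>t\<bar>))) = 1 / k"
    using set_borel_integral_eq_integral(2)[OF si] hi' by (simp add: integral_unique)
qed

text \<open>Order \<open>q = 2\<close>: l'Hospital's rule turns the second derivative at \<open>p\<close> into the quadratic behaviour of
  \<open>f p - f y\<close>, and the limit is a Gaussian integral.\<close>

lemma laplace_interior_max:
  fixes f f' :: "real \<Rightarrow> real"
  assumes der: "\<And>y. (f has_real_derivative f' y) (at y)"
    and "a < p" "p < d"
    and max: "\<And>y. a \<le> y \<Longrightarrow> y \<le> d \<Longrightarrow> y \<noteq> p \<Longrightarrow> f y < f p"
    and "f' p = 0" and der2: "(f' has_real_derivative - k) (at p)" and "0 < k"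
  shows "((\<lambda>\<epsilon>. integral {a..d} (\<lambda>y. exp ((f y - f p) / \<epsilon>)) / sqrt \<epsilon>)
    \<longlongrightarrow> sqrt (2 * pi / k)) (at_right 0)"
proof -
  define g where "g y = f p - f y" for y
  have der_g: "(g has_real_derivative - f' y) (at y)" for y
    unfolding g_def by (auto intro!: derivative_eq_intros der)
  have cont_g: "continuous_on X g" for X
    using der_g by (meson DERIV_isCont continuous_at_imp_continuous_on)
  have lim: "((\<lambda>y. g y / (y - p)\<^sup>2) \<longlongrightarrow> k / 2) (at p)"
  proof (rule lhopital)
    show "(g \<longlongrightarrow> 0) (at p)"
      using DERIV_isCont[OF der_g[of p]] by (simp add: isCont_def g_def)
    have "((\<lambda>y. (y - p)\<^sup>2) \<longlongrightarrow> (p - p)\<^sup>2) (at p)" by (intro tendsto_intros)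
    then show "((\<lambda>y. (y - p)\<^sup>2) \<longlongrightarrow> 0) (at p)" by simp
    show "\<forall>\<^sub>F y in at p. (y - p)\<^sup>2 \<noteq> 0" "\<forall>\<^sub>F y in at p. 2 * (y - p) \<noteq> 0"
      by (auto simp: eventually_at_filter)
    show "\<forall>\<^sub>F y in at p. (g has_real_derivative - f' y) (at y)" using der_g by simp
    show "\<forall>\<^sub>F y in at p. ((\<lambda>y. (y - p)\<^sup>2) has_real_derivative 2 * (y - p)) (at y)"
      by (rule always_eventually) (auto intro!: derivative_eq_intros)
    have "((\<lambda>y. - (1 / 2) * ((f' y - f' p) / (y - p))) \<longlongrightarrow> - (1 / 2) * - k) (at p)"
      using der2 by (intro tendsto_intros) (simp add: has_field_derivative_iff)
    moreover have "\<forall>\<^sub>F y in at p. - (1 / 2) * ((f' y - f' p) / (y - p)) = - f' y / (2 * (y - p))"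
      using \<open>f' p = 0\<close> by (auto simp: eventually_at_filter)
    ultimately show "((\<lambda>y. - f' y / (2 * (y - p))) \<longlongrightarrow> k / 2) (at p)"
      by (simp add: Lim_transform_eventually)
  qed
  have "((\<lambda>h. integral {a..d} (\<lambda>y. exp (- (g y / h\<^sup>2))) / h)
      \<longlongrightarrow> (LINT t:UNIV|lborel. exp (- (k / 2 * \<bar>t\<bar>\<^sup>2)))) (at_right 0)"
  proof (rule laplace_rescaled)
    show "((\<lambda>y. g y / \<bar>y - p\<bar>\<^sup>2) \<longlongrightarrow> k / 2) (at p within {a..d})"
      using tendsto_within_subset[OF lim] by simp
    show "\<forall>\<^sub>F h in at_right 0. p + h * t \<in> {a..d}" for t
    proof -
      have "((\<lambda>h. p + h * t) \<longlongrightarrow> p + 0 * t) (at_right 0)" by (intro tendsto_intros)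
      then have "\<forall>\<^sub>F h in at_right 0. p + h * t \<in> {a<..<d}"
        using assms by (intro topological_tendstoD) auto
      then show ?thesis by eventually_elim auto
    qed
    show "set_integrable lborel UNIV (\<lambda>t. exp (- (c * \<bar>t\<bar>\<^sup>2)))" if "0 < c" for c :: real
      using gaussian_integral(1)[OF that] by (simp add: set_integrable_def)
  qed (use max \<open>0 < k\<close> cont_g in \<open>auto simp: g_def\<close>)
  moreover have "(LINT t:UNIV|lborel. exp (- (k / 2 * \<bar>t\<bar>\<^sup>2))) = sqrt (2 * pi / k)"
    using gaussian_integral(2)[of "k / 2"] \<open>0 < k\<close> by (simp add: set_lebesgue_integral_def mult.commute)
  ultimately have *: "((\<lambda>h. integral {a..d} (\<lambda>y. exp (- (g y / h\<^sup>2))) / h)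
      \<longlongrightarrow> sqrt (2 * pi / k)) (at_right 0)" by simp
  have "filterlim sqrt (at_right 0) (at_right 0)"
    unfolding filterlim_at
    using tendsto_real_sqrt[OF tendsto_ident_at, of 0 "{0<..}"]
    by (auto simp: eventually_at_filter)
  from filterlim_compose[OF * this]
  show ?thesis
  proof (rule Lim_transform_eventually)
    show "\<forall>\<^sub>F \<epsilon> in at_right 0. integral {a..d} (\<lambda>y. exp (- (g y / (sqrt \<epsilon>)\<^sup>2))) / sqrt \<epsilon>
        = integral {a..d} (\<lambda>y. exp ((f y - f p) / \<epsilon>)) / sqrt \<epsilon>"
      using eventually_at_right_less[of 0]
      by eventually_elim (simp add: g_def minus_divide_left)
  qed
qed

text \<open>Order \<open>q = 1\<close>: at an end point with nonzero slope the limit is an exponential integral, and the scale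
  is \<open>\<epsilon>\<close> rather than \<open>sqrt \<epsilon>\<close>.\<close>

lemma laplace_left_end_max:
  fixes f :: "real \<Rightarrow> real"
  assumes cont: "continuous_on {p..d} f" and "p < d"
    and max: "\<And>y. p < y \<Longrightarrow> y \<le> d \<Longrightarrow> f y < f p"
    and der: "(f has_real_derivative - k) (at p)" and "0 < k"
  shows "((\<lambda>\<epsilon>. integral {p..d} (\<lambda>y. exp ((f y - f p) / \<epsilon>)) / \<epsilon>) \<longlongrightarrow> 1 / k) (at_right 0)"
proof -
  define g where "g y = f p - f y" for y
  have "((\<lambda>y. - ((f y - f p) / (y - p))) \<longlongrightarrow> - (- k)) (at p)"
    using der by (intro tendsto_intros) (simp add: has_field_derivative_iff)
  from tendsto_within_subset[OF this, of "{p..d}"]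
  have "((\<lambda>y. - ((f y - f p) / (y - p))) \<longlongrightarrow> k) (at p within {p..d})"
    by simp
  moreover have "\<forall>\<^sub>F y in at p within {p..d}. - ((f y - f p) / (y - p)) = g y / \<bar>y - p\<bar> ^ 1"
    by (auto simp: eventually_at_filter g_def divide_simps)
  ultimately have lim: "((\<lambda>y. g y / \<bar>y - p\<bar> ^ 1) \<longlongrightarrow> k) (at p within {p..d})"
    by (rule Lim_transform_eventually)
  have "((\<lambda>h. integral {p..d} (\<lambda>y. exp (- (g y / h ^ 1))) / h)
      \<longlongrightarrow> (LINT t:{0..}|lborel. exp (- (k * \<bar>t\<bar> ^ 1)))) (at_right 0)"
  proof (rule laplace_rescaled[OF _ _ _ _ lim])
    show "continuous_on {p..d} g" unfolding g_def by (intro continuous_intros cont)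
    show "t \<in> {0..}" if "0 < h" "p + h * t \<in> {p..d}" for h t :: real
      using that by (simp add: zero_le_mult_iff)
    show "\<forall>\<^sub>F h in at_right 0. p + h * t \<in> {p..d}" if "t \<in> {0..}" for t
    proof -
      have "((\<lambda>h. p + h * t) \<longlongrightarrow> p + 0 * t) (at_right 0)" by (intro tendsto_intros)
      then have "\<forall>\<^sub>F h in at_right 0. p + h * t \<in> {..<d}"
        using assms by (intro topological_tendstoD) auto
      then show ?thesis using eventually_at_right_less[of 0] by eventually_elim (use that in auto)
    qed
    show "set_integrable lborel {0..} (\<lambda>t. exp (- (c * \<bar>t\<bar> ^ 1)))" if "0 < c" for c :: real
      using exponential_integral(1)[OF that] by simp
  qed (use max \<open>0 < k\<close> in \<open>auto simp: g_def\<close>)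
  then show ?thesis
    using exponential_integral(2)[OF \<open>0 < k\<close>] by (simp add: g_def minus_divide_left)
qed

section \<open>Potential and stationary density\<close>

lemma S_has_derivative:
  assumes "continuous_on UNIV b"
  shows "(S b has_real_derivative - b x) (at x)"
proof -
  define c where "c = \<bar>x\<bar> + 1"
  have "((\<lambda>u. LBINT y=0..u. b y) has_vector_derivative b x) (at x within {- c..c})"
    using interval_integral_FTC2[of "- c" 0 c b x] continuous_on_subset[OF assms]
    by (simp add: c_def zero_ereal_def)
  moreover have "at x within {- c..c} = at x"
    by (rule at_within_interior) (auto simp: c_def)
  ultimately have "((\<lambda>u. LBINT y=0..u. b y) has_real_derivative b x) (at x)"
    by (simp add: has_real_derivative_iff_has_vector_derivative zero_ereal_def)
  then show ?thesis
    unfolding S_def[abs_def] by (rule DERIV_minus)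
qed

lemma continuous_on_S: "continuous_on UNIV b \<Longrightarrow> continuous_on X (S b)"
  using S_has_derivative by (meson DERIV_isCont continuous_at_imp_continuous_on)

lemma S_decreasing_if_pos:
  assumes cont: "continuous_on UNIV b" and "x < y" "\<And>t. x < t \<Longrightarrow> t < y \<Longrightarrow> 0 < b t"
  shows "S b y < S b x"
proof (rule DERIV_neg_imp_decreasing_open[OF \<open>x < y\<close>])
  show "\<exists>d. (S b has_real_derivative d) (at t) \<and> d < 0" if "x < t" "t < y" for t
    using S_has_derivative[OF cont, of t] assms that by (intro exI[of _ "- b t"]) simp
qed (rule continuous_on_S[OF cont])

lemma S_increasing_if_neg:
  assumes cont: "continuous_on UNIV b" and "x < y" "\<And>t. x < t \<Longrightarrow> t < y \<Longrightarrow> b t < 0"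
  shows "S b x < S b y"
proof (rule DERIV_pos_imp_increasing_open[OF \<open>x < y\<close>])
  show "\<exists>d. (S b has_real_derivative d) (at t) \<and> 0 < d" if "x < t" "t < y" for t
    using S_has_derivative[OF cont, of t] assms that by (intro exI[of _ "- b t"]) simp
qed (rule continuous_on_S[OF cont])

text \<open>The increment over one period has derivative zero.\<close>

lemma S_shift:
  assumes cont: "continuous_on UNIV b" and per: "\<And>x. b (x + 1) = b x"
  shows "S b (x + 1) - S b x = S b (y + 1) - S b y"
proof (rule DERIV_isconst_all[of "\<lambda>x. S b (x + 1) - S b x"], rule allI)
  fix x
  have "((\<lambda>x. S b (x + 1)) has_real_derivative - b (x + 1)) (at x)"
    using S_has_derivative[OF cont, of "x + 1"] by (simp add: DERIV_shift)
  from DERIV_diff[OF this S_has_derivative[OF cont, of x]]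
  show "((\<lambda>x. S b (x + 1) - S b x) has_real_derivative 0) (at x)" by (simp add: per)
qed

text \<open>
  For a continuous function \<open>e\<close> an antiderivative is \<open>- S e\<close>; with \<open>e = exp (S b / \<epsilon>)\<close> this gives \<open>pi_eps\<close> in
  closed form.\<close>

lemma continuous_on_pi_eps:
  assumes "continuous_on UNIV b" and "\<epsilon> \<noteq> 0"
  shows "continuous_on X (pi_eps b \<epsilon>)"
proof -
  define e where "e y = exp (S b y / \<epsilon>)" for y
  have e: "continuous_on X e" for X
    unfolding e_def using assms(2) by (intro continuous_intros continuous_on_S assms(1)) auto
  have E: "integral {x..x + 1} e = S e x - S e (x + 1)" for x
  proof -
    have "((\<lambda>y. - S e y) has_real_derivative e y) (at y)" for y
      using DERIV_minus[OF S_has_derivative[OF e]] by simp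
    then have "(e has_integral (- S e (x + 1) - - S e x)) {x..x + 1}"
      by (intro fundamental_theorem_of_calculus)
        (auto simp: has_real_derivative_iff_has_vector_derivative[symmetric]
          intro: has_field_derivative_at_within)
    then show ?thesis by (simp add: integral_unique)
  qed
  have "pi_eps b \<epsilon> x = exp (- S b x / \<epsilon>) * (S e x - S e (x + 1))" for x
  proof -
    have "exp ((S b y - S b x) / \<epsilon>) = exp (- S b x / \<epsilon>) * e y" for y
      by (simp add: e_def diff_divide_distrib flip: exp_add)
    then show ?thesis using E[of x] by (simp add: pi_eps_def)
  qed
  then have "pi_eps b \<epsilon> = (\<lambda>x. exp (- S b x / \<epsilon>) * (S e x - S e (x + 1)))"
    by (rule ext)
  moreover have "continuous_on X (\<lambda>x. exp (- S b x / \<epsilon>) * (S e x - S e (x + 1)))"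
    using assms(2) by (intro continuous_intros continuous_on_S assms(1) e
        continuous_on_compose2[of UNIV "S e" X "\<lambda>x. x + 1"]) auto
  ultimately show ?thesis by simp
qed

lemma pi_eps_shift:
  assumes "continuous_on UNIV b" "\<And>x. b (x + 1) = b x"
  shows "pi_eps b \<epsilon> (x + 1) = pi_eps b \<epsilon> x"
proof -
  have "S b (y + 1) - S b (x + 1) = S b y - S b x" for y
    using S_shift[of b y x] assms by simp
  then show ?thesis
    using integral_shift_real_ivl[of "x + 1" 1 "x + 2" "\<lambda>y. exp ((S b y - S b (x + 1)) / \<epsilon>)"]
    by (simp add: pi_eps_def add.assoc add.commute)
qed

lemma c_eps_shift:
  assumes "continuous_on UNIV b" "\<And>x. b (x + 1) = b x" "0 < \<epsilon>" "0 \<le> p" "p \<le> 1"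
  shows "c_eps b \<epsilon> = integral {p..p + 1} (pi_eps b \<epsilon>)"
proof -
  have int: "pi_eps b \<epsilon> integrable_on {u..v}" for u v
    using assms by (intro integrable_continuous_interval continuous_on_pi_eps) auto
  have "integral {0..p} (pi_eps b \<epsilon>) = integral {1..p + 1} (pi_eps b \<epsilon>)"
    using integral_shift_real_ivl[of 1 1 "p + 1" "pi_eps b \<epsilon>"] pi_eps_shift[of b] assms by simp
  moreover have "integral {0..p} (pi_eps b \<epsilon>) + integral {p..1} (pi_eps b \<epsilon>) = c_eps b \<epsilon>"
    unfolding c_eps_def using assms
    by (intro Henstock_Kurzweil_Integration.integral_combine int) auto
  moreover have "integral {p..1} (pi_eps b \<epsilon>) + integral {1..p + 1} (pi_eps b \<epsilon>)
      = integral {p..p + 1} (pi_eps b \<epsilon>)"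
    using assms by (intro Henstock_Kurzweil_Integration.integral_combine int) auto
  ultimately show ?thesis by simp
qed

section \<open>Asymptotics in a single well\<close>

text \<open>A well of \<open>S\<close> with bottom \<open>m\<close>: the descent starts at \<open>a\<close>, which lies higher than the local maximum \<open>M\<close> on
  the other side. The last assumption, that beyond \<open>M\<close> the height \<open>S b M\<close> is never reached again,
  makes the maximum of \<open>S\<close> over \<open>{x..}\<close> explicit for every \<open>x\<close> between \<open>a\<close> and \<open>M\<close>.\<close>

locale potential_well =
  fixes b :: "real \<Rightarrow> real" and a m M :: real
  assumes cont_b: "continuous_on UNIV b"
    and diff_m: "b differentiable at m" and diff_M: "b differentiable at M"
    and a_m: "a < m" and m_M: "m < M" and M_a: "M \<le> a + 1"
    and b_m: "b m = 0" and b_M: "b M = 0"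
    and deriv_m: "deriv b m < 0" and deriv_M: "0 < deriv b M"
    and downhill: "\<And>x. a < x \<Longrightarrow> x < m \<Longrightarrow> 0 < b x"
    and uphill: "\<And>x. m < x \<Longrightarrow> x < M \<Longrightarrow> b x < 0"
    and a_above_M: "S b M < S b a"
    and below_M_right: "\<And>y. M < y \<Longrightarrow> S b y < S b M"
begin

text \<open>The point on the slope below \<open>a\<close> at the height of \<open>M\<close>: the saddle interval is \<open>{a<..<foot}\<close>, the valley is
  \<open>{foot<..<M}\<close>.\<close>

definition foot :: real where
  "foot = Inf {x. x > a \<and> S b x = S b M}"

lemma S_deriv: "(S b has_real_derivative - b x) (at x)"
  by (rule S_has_derivative[OF cont_b])

lemma S_cont: "continuous_on X (S b)"
  by (rule continuous_on_S[OF cont_b])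

lemma S_decreasing: "a \<le> x \<Longrightarrow> x < y \<Longrightarrow> y \<le> m \<Longrightarrow> S b y < S b x"
  using S_decreasing_if_pos[OF cont_b, of x y] downhill by simp

lemma S_increasing: "m \<le> x \<Longrightarrow> x < y \<Longrightarrow> y \<le> M \<Longrightarrow> S b x < S b y"
  using S_increasing_if_neg[OF cont_b, of x y] uphill by simp

lemma foot_props: "a < foot" "foot < m" "S b foot = S b M"
proof -
  obtain x where x: "a \<le> x" "x \<le> m" "S b x = S b M"
    using IVT2'[of "S b" m "S b M" a] S_increasing[of m M] a_above_M a_m m_M S_cont by auto
  then have "a < x" "x < m"
    using a_above_M S_increasing[of m M] m_M by (cases "x = a"; cases "x = m"; simp)+
  have "foot = x"
    unfolding foot_def
  proof (rule cInf_eq_minimum)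
    show "x \<in> {x. x > a \<and> S b x = S b M}" using x \<open>a < x\<close> by simp
    show "x \<le> y" if "y \<in> {x. x > a \<and> S b x = S b M}" for y
      using S_decreasing[of y x] that x by (cases "x \<le> y") simp_all
  qed
  then show "a < foot" "foot < m" "S b foot = S b M" using x \<open>a < x\<close> \<open>x < m\<close> by auto
qed

lemma below_M:
  assumes "foot < y" "y \<noteq> M"
  shows "S b y < S b M"
proof -
  consider "y \<le> m" | "m < y" "y < M" | "M < y" using assms(2) by linarith
  then show ?thesis
  proof cases
    case 1
    then show ?thesis using S_decreasing[of foot y] assms foot_props by simp
  next
    case 2
    then show ?thesis using S_increasing[of y M] by simp
  next
    case 3
    then show ?thesis by (rule below_M_right)
  qed
qed

lemma below_slope:
  assumes "a \<le> x" "x < foot" "x < y"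
  shows "S b y < S b x"
proof (cases "y \<le> foot")
  case True
  then show ?thesis using S_decreasing[of x y] assms foot_props by simp
next
  case False
  then have "S b y \<le> S b M" using below_M[of y] by (cases "y = M") simp_all
  also have "\<dots> < S b x" using S_decreasing[of x foot] assms foot_props by simp
  finally show ?thesis .
qed

lemma below_slope_le:
  assumes "a \<le> x" "x \<le> foot" "x \<le> y"
  shows "S b y \<le> S b x"
proof -
  consider "y = x" | "x < foot" "x < y" | "x = foot" "y = M" | "x = foot" "foot < y" "y \<noteq> M"
    using assms by linarith
  then show ?thesis
  proof cases
    case 2
    then show ?thesis using below_slope[of x y] assms by simp
  next
    case 4
    then show ?thesis using below_M[of y] foot_props(3) by simp
  qed (simp_all add: foot_props(3))
qed

lemma above_m:
  assumes "a \<le> x" "x \<le> M" "x \<noteq> m"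
  shows "S b m < S b x"
  using S_decreasing[of x m] S_increasing[of m x] assms by linarith

lemma Vhat_valley:
  assumes "foot < x" "x < M"
  shows "Vhat b x = S b x - S b M"
proof -
  have "zmax b x = M"
    unfolding zmax_def
  proof (rule Greatest_equality)
    have "S b y \<le> S b M" if "x \<le> y" for y
      using below_M[of y] assms that by (cases "y = M") simp_all
    then show "x \<le> M \<and> (\<forall>y\<ge>x. S b y \<le> S b M)" using assms by simp
    show "y \<le> M" if "x \<le> y \<and> (\<forall>z\<ge>x. S b z \<le> S b y)" for y
    proof (rule ccontr)
      assume "\<not> y \<le> M"
      then have "S b y < S b M" using below_M_right by simp
      moreover have "S b M \<le> S b y" using that assms by simp
      ultimately show False by simp
    qed
  qed
  then show ?thesis by (simp add: Vhat_def)
qed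

lemma Vhat_saddle:
  assumes "a < x" "x < foot"
  shows "Vhat b x = 0"
proof -
  have "zmax b x = x"
    unfolding zmax_def
  proof (rule Greatest_equality)
    show "x \<le> x \<and> (\<forall>y\<ge>x. S b y \<le> S b x)"
      using below_slope_le assms by simp
    show "y \<le> x" if "x \<le> y \<and> (\<forall>z\<ge>x. S b z \<le> S b y)" for y
    proof (rule ccontr)
      assume "\<not> y \<le> x"
      then have "S b y < S b x" using below_slope assms by simp
      moreover have "S b x \<le> S b y" using that by simp
      ultimately show False by simp
    qed
  qed
  then show ?thesis by (simp add: Vhat_def)
qed

text \<open>All integrals below are normalised by the height at \<open>M\<close> or the depth at \<open>m\<close>, so that their
  integrands do not depend on the starting point \<open>x\<close> of \<open>pi_eps b \<epsilon> x\<close>.\<close>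

abbreviation peak :: "real \<Rightarrow> real \<Rightarrow> real \<Rightarrow> real" where
  "peak u v \<epsilon> \<equiv> integral {u..v} (\<lambda>y. exp ((S b y - S b M) / \<epsilon>))"

abbreviation bottom :: "real \<Rightarrow> real \<Rightarrow> real \<Rightarrow> real" where
  "bottom u v \<epsilon> \<equiv> integral {u..v} (\<lambda>x. exp ((S b m - S b x) / \<epsilon>))"

lemma peak_integrable: "0 < \<epsilon> \<Longrightarrow> (\<lambda>y. exp ((S b y - S b M) / \<epsilon>)) integrable_on {u..v}"
  by (rule integrable_continuous_interval) (intro continuous_intros S_cont, simp)

lemma bottom_integrable: "0 < \<epsilon> \<Longrightarrow> (\<lambda>y. exp ((S b m - S b y) / \<epsilon>)) integrable_on {u..v}"
  by (rule integrable_continuous_interval) (intro continuous_intros S_cont, simp)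

lemma pi_eps_integrable: "0 < \<epsilon> \<Longrightarrow> pi_eps b \<epsilon> integrable_on {u..v}"
  by (rule integrable_continuous_interval) (simp add: continuous_on_pi_eps cont_b)

lemma pi_eps_nonneg: "0 < \<epsilon> \<Longrightarrow> 0 \<le> pi_eps b \<epsilon> x"
  unfolding pi_eps_def
  by (intro integral_nonneg integrable_continuous_interval continuous_intros S_cont) simp_all

lemma pi_eps_peak: "pi_eps b \<epsilon> x = exp ((S b M - S b x) / \<epsilon>) * peak x (x + 1) \<epsilon>"
proof -
  have "exp ((S b y - S b x) / \<epsilon>) = exp ((S b M - S b x) / \<epsilon>) * exp ((S b y - S b M) / \<epsilon>)" for y
    by (simp add: diff_divide_distrib flip: exp_add)
  then have "pi_eps b \<epsilon> x
      = integral {x..x + 1} (\<lambda>y. exp ((S b M - S b x) / \<epsilon>) * exp ((S b y - S b M) / \<epsilon>))"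
    unfolding pi_eps_def by (rule integral_cong)
  then show ?thesis by simp
qed

lemma peak_mono:
  assumes "0 < \<epsilon>" "u' \<le> u" "v \<le> v'"
  shows "peak u v \<epsilon> \<le> peak u' v' \<epsilon>"
  using assms by (intro integral_subset_le peak_integrable) auto

lemma S_neg_second_derivative:
  "((\<lambda>x. - b x) has_real_derivative - deriv b M) (at M)"
  using DERIV_minus[of b "deriv b M" M UNIV] diff_M by (simp add: DERIV_deriv_iff_real_differentiable)

lemma peak_asymptotics_interior:
  assumes "foot < u" "u < M" "M < v"
  shows "((\<lambda>\<epsilon>. peak u v \<epsilon> / sqrt \<epsilon>) \<longlongrightarrow> omega_weight b M) (at_right 0)"
  unfolding omega_weight_def
proof (rule laplace_interior_max[OF S_deriv])
  show "S b y < S b M" if "u \<le> y" "y \<le> v" "y \<noteq> M" for y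
    using below_M[of y] that assms by simp
qed (use assms b_M deriv_M S_neg_second_derivative in auto)

text \<open>The interval starting at \<open>foot\<close> contains two points of height \<open>S b M\<close>. The slope at \<open>foot\<close>
  contributes order \<open>\<epsilon>\<close>, so only the Gaussian peak at \<open>M\<close> survives division by \<open>sqrt \<epsilon>\<close>.\<close>

lemma peak_asymptotics:
  assumes "M < v"
  shows "((\<lambda>\<epsilon>. peak foot v \<epsilon> / sqrt \<epsilon>) \<longlongrightarrow> omega_weight b M) (at_right 0)"
proof -
  have "((\<lambda>\<epsilon>. integral {foot..m} (\<lambda>y. exp ((S b y - S b foot) / \<epsilon>)) / \<epsilon>) \<longlongrightarrow> 1 / b foot) (at_right 0)"
  proof (rule laplace_left_end_max)
    show "(S b has_real_derivative - b foot) (at foot)" by (rule S_deriv)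
    show "S b y < S b foot" if "foot < y" "y \<le> m" for y
      using S_decreasing[of foot y] foot_props that by simp
    show "0 < b foot" using downhill foot_props by simp
  qed (use foot_props S_cont in auto)
  then have slope: "((\<lambda>\<epsilon>. peak foot m \<epsilon> / \<epsilon>) \<longlongrightarrow> 1 / b foot) (at_right 0)"
    by (simp add: foot_props)
  have "(sqrt \<longlongrightarrow> 0) (at_right 0)"
    using tendsto_real_sqrt[OF tendsto_ident_at, of 0 "{0<..}"] by simp
  from tendsto_add[OF tendsto_mult[OF this slope] peak_asymptotics_interior[OF foot_props(2) m_M assms]]
  have "((\<lambda>\<epsilon>. sqrt \<epsilon> * (peak foot m \<epsilon> / \<epsilon>) + peak m v \<epsilon> / sqrt \<epsilon>) \<longlongrightarrow> omega_weight b M) (at_right 0)"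
    by simp
  moreover have "\<forall>\<^sub>F \<epsilon> in at_right 0. sqrt \<epsilon> * (peak foot m \<epsilon> / \<epsilon>) + peak m v \<epsilon> / sqrt \<epsilon>
      = peak foot v \<epsilon> / sqrt \<epsilon>"
    using eventually_at_right_less[of 0]
  proof eventually_elim
    case (elim \<epsilon>)
    have "peak foot m \<epsilon> + peak m v \<epsilon> = peak foot v \<epsilon>"
      using foot_props m_M assms elim
      by (intro Henstock_Kurzweil_Integration.integral_combine peak_integrable) auto
    moreover have "sqrt \<epsilon> * (peak foot m \<epsilon> / \<epsilon>) = peak foot m \<epsilon> / sqrt \<epsilon>"
      using elim by (simp add: field_simps)
    ultimately show ?case by (simp flip: add_divide_distrib)
  qed
  ultimately show ?thesis by (rule Lim_transform_eventually)
qed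

text \<open>Bounds independent of \<open>x\<close>. The lower one is useful for \<open>u < M\<close>, when the interval \<open>{u..foot + 1}\<close> has the
  peak in its interior; it is the reason for staying away from \<open>M\<close>.\<close>

lemma peak_bounds:
  assumes "0 < \<epsilon>" "foot \<le> x" "x \<le> M"
  shows "peak x (x + 1) \<epsilon> \<le> peak foot (M + 1) \<epsilon>"
    and "x \<le> u \<Longrightarrow> peak u (foot + 1) \<epsilon> \<le> peak x (x + 1) \<epsilon>"
  using assms by (auto intro!: peak_mono)

lemma bottom_asymptotics:
  assumes "a \<le> u" "u < m" "m < v" "v \<le> M"
  shows "((\<lambda>\<epsilon>. bottom u v \<epsilon> / sqrt \<epsilon>) \<longlongrightarrow> sigma_weight b m) (at_right 0)"
proof -
  have "((\<lambda>\<epsilon>. integral {u..v} (\<lambda>x. exp ((- S b x - - S b m) / \<epsilon>)) / sqrt \<epsilon>)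
      \<longlongrightarrow> sqrt (2 * pi / (- deriv b m))) (at_right 0)"
  proof (rule laplace_interior_max)
    show "((\<lambda>x. - S b x) has_real_derivative b x) (at x)" for x
      using DERIV_minus[OF S_deriv] by simp
    show "(b has_real_derivative - (- deriv b m)) (at m)"
      using diff_m by (simp add: DERIV_deriv_iff_real_differentiable)
    show "- S b y < - S b m" if "u \<le> y" "y \<le> v" "y \<noteq> m" for y
      using above_m[of y] that assms by simp
  qed (use assms b_m deriv_m in auto)
  then show ?thesis by (simp add: sigma_weight_def)
qed

lemma saddle_asymptotics:
  assumes "a < x" "x < foot"
  shows "((\<lambda>\<epsilon>. pi_eps b \<epsilon> x / \<epsilon>) \<longlongrightarrow> 1 / b x) (at_right 0)"
  unfolding pi_eps_def
proof (rule laplace_left_end_max)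
  show "(S b has_real_derivative - b x) (at x)" by (rule S_deriv)
  show "0 < b x" using downhill assms foot_props by simp
  show "S b y < S b x" if "x < y" for y
    using below_slope assms that by simp
qed (use S_cont in auto)

text \<open>On the valley, \<open>pi_eps b \<epsilon> x\<close> is \<open>exp ((S b M - S b x) / \<epsilon>)\<close> times a factor with \<open>x\<close>-independent bounds, so
  the double integral is bounded from both sides by products of two Laplace integrals, at \<open>m\<close> and at \<open>M\<close>. On the saddle
  interval \<open>S\<close> is maximal at the starting point, hence \<open>pi_eps \<le> 1\<close>. For the lower
  bound it is enough to integrate over \<open>{foot..u}\<close> with \<open>m < u < M\<close>.\<close>

lemma mass_asymptotics:
  "((\<lambda>\<epsilon>. integral {a..M} (pi_eps b \<epsilon>) / (\<epsilon> * exp ((S b M - S b m) / \<epsilon>)))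
    \<longlongrightarrow> sigma_weight b m * omega_weight b M) (at_right 0)"
proof -
  define u where "u = (m + M) / 2"
  define H where "H = S b M - S b m"
  have u: "m < u" "u < M" using m_M by (simp_all add: u_def)
  have "M < foot + 1" using foot_props M_a by simp
  have "0 < H" using above_m[of M] a_m m_M by (simp add: H_def)
  note lu = foot_props u
  define lo where "lo \<epsilon> = (bottom foot u \<epsilon> / sqrt \<epsilon>) * (peak u (foot + 1) \<epsilon> / sqrt \<epsilon>)" for \<epsilon>
  define hi where "hi \<epsilon> = (foot - a) / (\<epsilon> * exp (H / \<epsilon>))
    + (bottom foot M \<epsilon> / sqrt \<epsilon>) * (peak foot (M + 1) \<epsilon> / sqrt \<epsilon>)" for \<epsilon>
  have eq: "pi_eps b \<epsilon> x = exp (H / \<epsilon>) * (exp ((S b m - S b x) / \<epsilon>) * peak x (x + 1) \<epsilon>)" for \<epsilon> x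
    by (simp add: pi_eps_peak H_def diff_divide_distrib flip: exp_add mult.assoc)
  have lower: "lo \<epsilon> \<le> integral {a..M} (pi_eps b \<epsilon>) / (\<epsilon> * exp (H / \<epsilon>))" if "0 < \<epsilon>" for \<epsilon>
  proof -
    have "exp (H / \<epsilon>) * (bottom foot u \<epsilon> * peak u (foot + 1) \<epsilon>)
        = integral {foot..u} (\<lambda>x. exp (H / \<epsilon>) * (exp ((S b m - S b x) / \<epsilon>) * peak u (foot + 1) \<epsilon>))"
      by simp
    also have "\<dots> \<le> integral {foot..u} (pi_eps b \<epsilon>)"
    proof (rule integral_le)
      show "(\<lambda>x. exp (H / \<epsilon>) * (exp ((S b m - S b x) / \<epsilon>) * peak u (foot + 1) \<epsilon>)) integrable_on {foot..u}"
        by (intro integrable_on_mult_right integrable_on_mult_left bottom_integrable that)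
      show "pi_eps b \<epsilon> integrable_on {foot..u}" by (rule pi_eps_integrable[OF that])
      show "exp (H / \<epsilon>) * (exp ((S b m - S b x) / \<epsilon>) * peak u (foot + 1) \<epsilon>) \<le> pi_eps b \<epsilon> x"
        if "x \<in> {foot..u}" for x
        unfolding eq using peak_bounds(2)[OF \<open>0 < \<epsilon>\<close>, of x u] that u by simp
    qed
    also have "\<dots> \<le> integral {a..M} (pi_eps b \<epsilon>)"
      using lu by (intro integral_subset_le pi_eps_integrable that ballI pi_eps_nonneg) auto
    finally have "exp (H / \<epsilon>) * (bottom foot u \<epsilon> * peak u (foot + 1) \<epsilon>) / (\<epsilon> * exp (H / \<epsilon>))
        \<le> integral {a..M} (pi_eps b \<epsilon>) / (\<epsilon> * exp (H / \<epsilon>))"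
      using that by (intro divide_right_mono) auto
    then show ?thesis using that by (simp add: lo_def)
  qed
  have upper: "integral {a..M} (pi_eps b \<epsilon>) / (\<epsilon> * exp (H / \<epsilon>)) \<le> hi \<epsilon>" if "0 < \<epsilon>" for \<epsilon>
  proof -
    have "integral {a..foot} (pi_eps b \<epsilon>) \<le> integral {a..foot} (\<lambda>_. 1)"
    proof (rule integral_le)
      show "pi_eps b \<epsilon> integrable_on {a..foot}" by (rule pi_eps_integrable[OF that])
      show "pi_eps b \<epsilon> x \<le> 1" if x: "x \<in> {a..foot}" for x
      proof -
        have "S b y \<le> S b x" if "x \<le> y" for y
          using below_slope_le[of x y] x that by simp
        then have "pi_eps b \<epsilon> x \<le> integral {x..x + 1} (\<lambda>_. 1)"
          unfolding pi_eps_def using \<open>0 < \<epsilon>\<close>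
          by (intro integral_le integrable_continuous_interval continuous_intros S_cont)
            (auto simp: divide_nonpos_pos)
        then show ?thesis by simp
      qed
    qed auto
    then have 1: "integral {a..foot} (pi_eps b \<epsilon>) \<le> foot - a" using foot_props by simp
    have "integral {foot..M} (pi_eps b \<epsilon>)
      \<le> integral {foot..M} (\<lambda>x. exp (H / \<epsilon>) * (exp ((S b m - S b x) / \<epsilon>) * peak foot (M + 1) \<epsilon>))"
    proof (rule integral_le)
      show "(\<lambda>x. exp (H / \<epsilon>) * (exp ((S b m - S b x) / \<epsilon>) * peak foot (M + 1) \<epsilon>)) integrable_on {foot..M}"
        by (intro integrable_on_mult_right integrable_on_mult_left bottom_integrable that)
      show "pi_eps b \<epsilon> integrable_on {foot..M}" by (rule pi_eps_integrable[OF that])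
      show "pi_eps b \<epsilon> x \<le> exp (H / \<epsilon>) * (exp ((S b m - S b x) / \<epsilon>) * peak foot (M + 1) \<epsilon>)"
        if "x \<in> {foot..M}" for x
        unfolding eq using peak_bounds(1)[OF \<open>0 < \<epsilon>\<close>, of x] that by simp
    qed
    also have "\<dots> = exp (H / \<epsilon>) * (bottom foot M \<epsilon> * peak foot (M + 1) \<epsilon>)" by simp
    finally have 2: "integral {foot..M} (pi_eps b \<epsilon>) \<le> exp (H / \<epsilon>) * (bottom foot M \<epsilon> * peak foot (M + 1) \<epsilon>)" .
    have "integral {a..foot} (pi_eps b \<epsilon>) + integral {foot..M} (pi_eps b \<epsilon>) = integral {a..M} (pi_eps b \<epsilon>)"
      using lu by (intro Henstock_Kurzweil_Integration.integral_combine pi_eps_integrable that) auto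
    then have "integral {a..M} (pi_eps b \<epsilon>)
        \<le> (foot - a) + exp (H / \<epsilon>) * (bottom foot M \<epsilon> * peak foot (M + 1) \<epsilon>)"
      using 1 2 by linarith
    then have "integral {a..M} (pi_eps b \<epsilon>) / (\<epsilon> * exp (H / \<epsilon>))
        \<le> ((foot - a) + exp (H / \<epsilon>) * (bottom foot M \<epsilon> * peak foot (M + 1) \<epsilon>)) / (\<epsilon> * exp (H / \<epsilon>))"
      using that by (intro divide_right_mono) auto
    then show ?thesis using that by (simp add: hi_def add_divide_distrib)
  qed
  have lo: "(lo \<longlongrightarrow> sigma_weight b m * omega_weight b M) (at_right 0)"
    unfolding lo_def using lu \<open>M < foot + 1\<close>
    by (intro tendsto_mult bottom_asymptotics peak_asymptotics_interior) auto
  have "((\<lambda>\<epsilon>. d / (\<epsilon> * exp (H / \<epsilon>))) \<longlongrightarrow> 0) (at_right 0)" if "0 < d" for d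
    using \<open>0 < H\<close> that by real_asymp
  from this[of "foot - a"] have "((\<lambda>\<epsilon>. (foot - a) / (\<epsilon> * exp (H / \<epsilon>))) \<longlongrightarrow> 0) (at_right 0)"
    using foot_props by simp
  then have hi: "(hi \<longlongrightarrow> 0 + sigma_weight b m * omega_weight b M) (at_right 0)"
    unfolding hi_def using lu m_M
    by (intro tendsto_add tendsto_mult bottom_asymptotics peak_asymptotics) auto
  show ?thesis
    unfolding H_def[symmetric]
  proof (rule tendsto_sandwich[OF _ _ lo])
    show "(hi \<longlongrightarrow> sigma_weight b m * omega_weight b M) (at_right 0)" using hi by simp
    show "\<forall>\<^sub>F \<epsilon> in at_right 0. lo \<epsilon> \<le> integral {a..M} (pi_eps b \<epsilon>) / (\<epsilon> * exp (H / \<epsilon>))"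
      using eventually_at_right_less[of 0] by eventually_elim (rule lower)
    show "\<forall>\<^sub>F \<epsilon> in at_right 0. integral {a..M} (pi_eps b \<epsilon>) / (\<epsilon> * exp (H / \<epsilon>)) \<le> hi \<epsilon>"
      using eventually_at_right_less[of 0] by eventually_elim (rule upper)
  qed
qed

lemma omega_pos: "0 < omega_weight b M"
  using deriv_M by (simp add: omega_weight_def)

lemma sigma_pos: "0 < sigma_weight b m"
  using deriv_m by (simp add: sigma_weight_def divide_pos_neg)

text \<open>
  The prefactor is normalised by the mass of all wells, so its asymptotics in one well need the asymptotics
  of \<open>c_eps\<close> as an input.\<close>

context
  fixes H Z :: real
  assumes partition: "((\<lambda>\<epsilon>. c_eps b \<epsilon> / (\<epsilon> * exp (H / \<epsilon>))) \<longlongrightarrow> Z) (at_right 0)"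
    and Z_pos: "0 < Z"
begin

lemma eventually_partition_pos: "\<forall>\<^sub>F \<epsilon> in at_right 0. 0 < c_eps b \<epsilon> / (\<epsilon> * exp (H / \<epsilon>))"
  using partition Z_pos by (rule order_tendstoD)

text \<open>The prefactor over its predicted value is \<open>peak x (x + 1) \<epsilon> / sqrt \<epsilon>\<close> times a factor that does not depend on
  \<open>x\<close>; the bounds \<open>lo\<close> and \<open>hi\<close> on it do not depend on \<open>x\<close> either and both tend to 1.\<close>

lemma prefactor_valley:
  assumes "0 < \<delta>"
  shows "uniform_limit {x. foot < x \<and> x < M - \<delta>}
    (\<lambda>\<epsilon> x. prefactor b H \<epsilon> x / (omega_weight b M / (Z * sqrt \<epsilon>)) - 1) (\<lambda>_. 0) (at_right 0)"
proof -
  \<comment> \<open>The maximum keeps \<open>u\<close> above \<open>foot\<close> when \<open>\<delta>\<close> exceeds the width of the valley.\<close>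
  define u where "u = max (M - \<delta>) ((foot + M) / 2)"
  have u: "foot < u" "u < M" "M - \<delta> \<le> u" "M < foot + 1"
    using assms foot_props m_M M_a by (auto simp: u_def less_max_iff_disj)
  define c where "c \<epsilon> = c_eps b \<epsilon> / (\<epsilon> * exp (H / \<epsilon>))" for \<epsilon>
  define lo where "lo \<epsilon> = peak u (foot + 1) \<epsilon> / sqrt \<epsilon> * (Z / (c \<epsilon> * omega_weight b M))" for \<epsilon>
  define hi where "hi \<epsilon> = peak foot (M + 1) \<epsilon> / sqrt \<epsilon> * (Z / (c \<epsilon> * omega_weight b M))" for \<epsilon>
  have c: "(c \<longlongrightarrow> Z) (at_right 0)" unfolding c_def by (rule partition)
  have "(lo \<longlongrightarrow> omega_weight b M * (Z / (Z * omega_weight b M))) (at_right 0)"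
    unfolding lo_def using u omega_pos Z_pos
    by (intro tendsto_intros peak_asymptotics_interior c) auto
  then have lo: "(lo \<longlongrightarrow> 1) (at_right 0)" using omega_pos Z_pos by simp
  have "(hi \<longlongrightarrow> omega_weight b M * (Z / (Z * omega_weight b M))) (at_right 0)"
    unfolding hi_def using omega_pos Z_pos
    by (intro tendsto_intros peak_asymptotics c) auto
  then have hi: "(hi \<longlongrightarrow> 1) (at_right 0)" using omega_pos Z_pos by simp
  have bounds: "lo \<epsilon> \<le> prefactor b H \<epsilon> x / (omega_weight b M / (Z * sqrt \<epsilon>))"
      "prefactor b H \<epsilon> x / (omega_weight b M / (Z * sqrt \<epsilon>)) \<le> hi \<epsilon>"
    if "0 < \<epsilon>" "0 < c \<epsilon>" "foot < x" "x < M - \<delta>" for \<epsilon> x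
  proof -
    have "x < M" using that assms by simp
    define w where "w = Z / (c \<epsilon> * omega_weight b M)"
    have "0 < w" using that omega_pos Z_pos by (simp add: w_def)
    have c_eq: "c_eps b \<epsilon> = c \<epsilon> * (\<epsilon> * exp (H / \<epsilon>))" using that by (simp add: c_def)
    have "exp ((S b M - S b x) / \<epsilon>) * exp (quasi_potential b H x / \<epsilon>) = exp (H / \<epsilon>)"
      unfolding quasi_potential_def Vhat_valley[OF that(3) \<open>x < M\<close>]
      by (simp add: diff_divide_distrib add_divide_distrib flip: exp_add)
    then have "pi_eps b \<epsilon> x * exp (quasi_potential b H x / \<epsilon>) = exp (H / \<epsilon>) * peak x (x + 1) \<epsilon>"
      by (simp add: pi_eps_peak mult_ac)
    then have "prefactor b H \<epsilon> x = exp (H / \<epsilon>) * peak x (x + 1) \<epsilon> / c_eps b \<epsilon>"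
      by (simp add: prefactor_def m_eps_def)
    also have "\<dots> = peak x (x + 1) \<epsilon> / (sqrt \<epsilon> * sqrt \<epsilon> * c \<epsilon>)"
      unfolding c_eq using that by simp
    finally have "prefactor b H \<epsilon> x / (omega_weight b M / (Z * sqrt \<epsilon>)) = peak x (x + 1) \<epsilon> / sqrt \<epsilon> * w"
      using that omega_pos Z_pos by (simp add: w_def del: real_sqrt_mult_self)
    moreover have "peak u (foot + 1) \<epsilon> \<le> peak x (x + 1) \<epsilon>" "peak x (x + 1) \<epsilon> \<le> peak foot (M + 1) \<epsilon>"
      using peak_bounds[OF that(1), of x] that u assms by auto
    ultimately show "lo \<epsilon> \<le> prefactor b H \<epsilon> x / (omega_weight b M / (Z * sqrt \<epsilon>))"
        "prefactor b H \<epsilon> x / (omega_weight b M / (Z * sqrt \<epsilon>)) \<le> hi \<epsilon>"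
      using \<open>0 < w\<close> that unfolding lo_def hi_def w_def[symmetric]
      by (auto intro!: mult_right_mono divide_right_mono)
  qed
  show ?thesis
  proof (rule uniform_limitI)
    fix e :: real
    assume "0 < e"
    have "\<forall>\<^sub>F \<epsilon> in at_right 0. 1 - e < lo \<epsilon>" "\<forall>\<^sub>F \<epsilon> in at_right 0. hi \<epsilon> < 1 + e"
      using \<open>0 < e\<close> by (auto intro: order_tendstoD lo hi)
    then show "\<forall>\<^sub>F \<epsilon> in at_right 0. \<forall>x\<in>{x. foot < x \<and> x < M - \<delta>}.
        dist (prefactor b H \<epsilon> x / (omega_weight b M / (Z * sqrt \<epsilon>)) - 1) 0 < e"
      using eventually_partition_pos eventually_at_right_less[of 0]
    proof eventually_elim
      case (elim \<epsilon>)
      show ?case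
      proof
        fix x
        assume "x \<in> {x. foot < x \<and> x < M - \<delta>}"
        then show "dist (prefactor b H \<epsilon> x / (omega_weight b M / (Z * sqrt \<epsilon>)) - 1) 0 < e"
          using bounds[of \<epsilon> x] elim by (auto simp: dist_real_def c_def)
      qed
    qed
  qed
qed

lemma prefactor_saddle:
  assumes "a < x" "x < foot"
  shows "((\<lambda>\<epsilon>. prefactor b H \<epsilon> x * (Z * b x) - 1) \<longlongrightarrow> 0) (at_right 0)"
proof -
  have "0 < b x" using downhill assms foot_props by simp
  have "((\<lambda>\<epsilon>. pi_eps b \<epsilon> x / \<epsilon> / (c_eps b \<epsilon> / (\<epsilon> * exp (H / \<epsilon>))) * (Z * b x) - 1)
      \<longlongrightarrow> 1 / b x / Z * (Z * b x) - 1) (at_right 0)"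
    using Z_pos by (intro tendsto_intros saddle_asymptotics partition assms) auto
  also have "1 / b x / Z * (Z * b x) - 1 = 0" using \<open>0 < b x\<close> Z_pos by simp
  finally show ?thesis
  proof (rule Lim_transform_eventually)
    show "\<forall>\<^sub>F \<epsilon> in at_right 0.
      pi_eps b \<epsilon> x / \<epsilon> / (c_eps b \<epsilon> / (\<epsilon> * exp (H / \<epsilon>))) * (Z * b x) - 1
      = prefactor b H \<epsilon> x * (Z * b x) - 1"
      using eventually_at_right_less[of 0]
    proof eventually_elim
      case (elim \<epsilon>)
      have "pi_eps b \<epsilon> x / \<epsilon> / (c_eps b \<epsilon> / (\<epsilon> * exp (H / \<epsilon>))) = prefactor b H \<epsilon> x"
        using elim by (simp add: prefactor_def m_eps_def quasi_potential_def Vhat_saddle[OF assms])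
      then show ?case by (simp only:)
    qed
  qed
qed

end

end

section \<open>The sign of the drift between critical points\<close>

lemma loc_max_eventually:
  assumes "loc_max f p"
  obtains e where "0 < e" "\<And>y. \<bar>p - y\<bar> < e \<Longrightarrow> f y \<le> f p"
proof -
  have "\<forall>\<^sub>F y in nhds p. f y \<le> f p" using assms by (simp add: loc_max_def)
  then obtain e where "0 < e" "\<And>y. dist y p < e \<Longrightarrow> f y \<le> f p"
    by (auto simp: eventually_nhds_metric)
  then show ?thesis using that by (simp add: dist_real_def abs_minus_commute)
qed

lemma zero_at_loc_max:
  assumes "continuous_on UNIV b" "loc_max (S b) p"
  shows "b p = 0"
proof -
  obtain e where "0 < e" "\<And>y. \<bar>p - y\<bar> < e \<Longrightarrow> S b y \<le> S b p"
    using loc_max_eventually[OF assms(2)] by blast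
  then have "- b p = 0" using DERIV_local_max[OF S_has_derivative[OF assms(1)]] by blast
  then show ?thesis by simp
qed

text \<open>Without zeros, \<open>b\<close> has constant sign on the interval; if it were negative, \<open>S\<close> would increase to the right
  of its local maximum.\<close>

lemma pos_right_of_loc_max:
  assumes cont: "continuous_on UNIV b" and max: "loc_max (S b) p"
    and nz: "\<And>x. p < x \<Longrightarrow> x < q \<Longrightarrow> b x \<noteq> 0" and "p < x" "x < q"
  shows "0 < b x"
proof (rule ccontr)
  assume "\<not> 0 < b x"
  then have "b x < 0" using nz[of x] assms by force
  have cont': "continuous_on X b" for X using cont continuous_on_subset by blast
  have neg: "b y < 0" if y: "p < y" "y < q" for y
  proof (rule ccontr)
    assume "\<not> b y < 0"
    then have "0 < b y" using nz[of y] y by force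
    have "\<exists>z. min x y \<le> z \<and> z \<le> max x y \<and> b z = 0"
    proof (cases "x \<le> y")
      case True
      then show ?thesis using IVT'[of b x 0 y] \<open>b x < 0\<close> \<open>0 < b y\<close> cont' by auto
    next
      case False
      then show ?thesis using IVT2'[of b x 0 y] \<open>b x < 0\<close> \<open>0 < b y\<close> cont' by auto
    qed
    then obtain z where "min x y \<le> z" "z \<le> max x y" "b z = 0" by blast
    then show False using nz[of z] assms(4,5) y by linarith
  qed
  obtain e where e: "0 < e" "\<And>y. \<bar>p - y\<bar> < e \<Longrightarrow> S b y \<le> S b p"
    using loc_max_eventually[OF max] by blast
  define y where "y = min ((p + q) / 2) (p + e / 2)"
  have y: "p < y" "y < q" "\<bar>p - y\<bar> < e"
    using assms(4,5) e(1) by (auto simp: y_def min_def abs_if field_simps)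
  have "S b p < S b y"
  proof (rule DERIV_pos_imp_increasing_open[OF y(1)])
    show "\<exists>d. (S b has_real_derivative d) (at t) \<and> 0 < d" if "p < t" "t < y" for t
      using S_has_derivative[OF cont, of t] neg[of t] that y(2) by (intro exI[of _ "- b t"]) simp
  qed (rule continuous_on_S[OF cont])
  then show False using e(2)[OF y(3)] by simp
qed

text \<open>The sign change of the drift reduces statements about local minima to those about local maxima.\<close>

lemma S_uminus: "S (\<lambda>x. - b x) = (\<lambda>x. - S b x)"
  by (simp add: fun_eq_iff S_def interval_lebesgue_integral_uminus)

lemma loc_min_uminus: "loc_min (S b) p \<Longrightarrow> loc_max (S (\<lambda>x. - b x)) p"
  by (simp add: loc_min_def loc_max_def S_uminus)

lemma zero_at_loc_min:
  assumes "continuous_on UNIV b" "loc_min (S b) p"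
  shows "b p = 0"
  using zero_at_loc_max[OF _ loc_min_uminus[OF assms(2)]] assms(1) by (simp add: continuous_on_minus)

lemma neg_right_of_loc_min:
  assumes "continuous_on UNIV b" and "loc_min (S b) p"
    and "\<And>x. p < x \<Longrightarrow> x < q \<Longrightarrow> b x \<noteq> 0" and "p < x" "x < q"
  shows "b x < 0"
  using pos_right_of_loc_max[OF _ loc_min_uminus[OF assms(2)], of q x] assms
  by (simp add: continuous_on_minus)

text \<open>At a nondegenerate zero the sign of \<open>b\<close> to its right decides the sign of the derivative: a negative
  derivative would make \<open>b\<close> negative there.\<close>

lemma deriv_pos_if_pos_right:
  fixes b :: "real \<Rightarrow> real"
  assumes "b differentiable at p" "b p = 0" "deriv b p \<noteq> 0" "p < q"
    and pos: "\<And>x. p < x \<Longrightarrow> x < q \<Longrightarrow> 0 < b x"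
  shows "0 < deriv b p"
proof (rule ccontr)
  assume "\<not> 0 < deriv b p"
  moreover have "(b has_real_derivative deriv b p) (at p)"
    using assms(1) by (simp add: DERIV_deriv_iff_real_differentiable)
  ultimately obtain d where d: "0 < d" "\<And>h. 0 < h \<Longrightarrow> h < d \<Longrightarrow> b (p + h) < 0"
    using DERIV_neg_dec_right[of b "deriv b p" p] assms(2,3) by auto
  define h where "h = min d (q - p) / 2"
  have "0 < h" "h < d" "p + h < q" using d(1) \<open>p < q\<close> by (auto simp: h_def min_def field_simps)
  then show False using d(2)[of h] pos[of "p + h"] by simp
qed

lemma deriv_neg_if_neg_right:
  fixes b :: "real \<Rightarrow> real"
  assumes "b differentiable at p" "b p = 0" "deriv b p \<noteq> 0" "p < q"
    and neg: "\<And>x. p < x \<Longrightarrow> x < q \<Longrightarrow> b x < 0"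
  shows "deriv b p < 0"
proof -
  have "deriv (\<lambda>x. - b x) p = - deriv b p"
    using assms(1) by (simp add: DERIV_imp_deriv DERIV_minus DERIV_deriv_iff_real_differentiable)
  then show ?thesis
    using deriv_pos_if_pos_right[of "\<lambda>x. - b x" p q] assms by simp
qed

text \<open>Each period lowers the values, so a strict maximum over one period remains one over the half-line.\<close>

lemma below_beyond_one_period:
  fixes f :: "real \<Rightarrow> real"
  assumes shift: "\<And>y. f (y + 1) < f y"
    and below: "\<And>y. p < y \<Longrightarrow> y \<le> p + 1 \<Longrightarrow> f y < f p" and "p < y"
  shows "f y < f p"
proof -
  have "f y < f p" if "p < y" "y \<le> p + 1 + real n" for n y
    using that
  proof (induction n arbitrary: y)
    case 0
    then show ?case using below by simp
  next
    case (Suc n)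
    show ?case
    proof (cases "y \<le> p + 1")
      case True
      then show ?thesis using below Suc by simp
    next
      case False
      then have "f (y - 1) < f p" using Suc by simp
      then show ?thesis using shift[of "y - 1"] by simp
    qed
  qed
  moreover obtain n where "y - p - 1 \<le> real n" using real_arch_simple by blast
  ultimately show ?thesis using \<open>p < y\<close> by (simp add: field_simps)
qed

section \<open>Both wells\<close>

theorem theorem3p1:
  fixes b :: "real \<Rightarrow> real" and M m :: "nat \<Rightarrow> real" and H :: real
  assumes smooth: "smooth b"
    and periodic: "\<And>x. b (x + 1) = b x"
    and four_zeros: "card {\<theta> \<in> {0..<1}. b \<theta> = 0} = 4"
    and nonzero_at_0: "b 0 \<noteq> 0"
    and nondegenerate: "\<And>\<theta>. \<theta> \<in> {0..<1} \<Longrightarrow> b \<theta> = 0 \<Longrightarrow> deriv b \<theta> \<noteq> 0"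
    and mean_pos: "integral {0..1} b > 0"
    and maxima: "{x \<in> {0..<1}. loc_max (S b) x} = {M 1, M 2}"
    and minima: "{x \<in> {0..<1}. loc_min (S b) x} = {m 1, m 2}"
    and order: "0 < M 1" "M 1 < m 1" "m 1 < M 2" "M 2 < m 2" "m 2 < 1"
    and M3: "M 3 = 1 + M 1"
    and heights: "S b (M 1) > S b (M 2)" "S b (M 2) > S b (M 3)"
    and depths: "Vhat b (m 1) = - H" "Vhat b (m 2) = - H"
  shows
    "(\<exists>r. (\<forall>i\<in>{1, 2}. \<forall>\<epsilon>>0. \<forall>x\<in>valley b M i.
            prefactor b H \<epsilon> x
              = (1 + r \<epsilon> x) * (omega_weight b (M (i + 1)) / (Z_weight b M m * sqrt \<epsilon>)))
       \<and> (\<forall>\<delta>>0. uniform_limit (\<Union>i\<in>{1, 2}. {x \<in> valley b M i. x < M (i + 1) - \<delta>})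
                  r (\<lambda>_. 0) (at_right 0)))
   \<and> (\<exists>r. (\<forall>i\<in>{1, 2}. \<forall>\<epsilon>>0. \<forall>x\<in>saddle_interval b M i.
            prefactor b H \<epsilon> x = (1 + r \<epsilon> x) * (1 / (Z_weight b M m * b x)))
       \<and> (\<forall>x\<in>saddle_interval b M 1 \<union> saddle_interval b M 2.
            ((\<lambda>\<epsilon>. r \<epsilon> x) \<longlongrightarrow> 0) (at_right 0)))"
proof -
  have diff: "b differentiable at x" for x
    using smooth[unfolded smooth_def, rule_format, of 0 x] by simp
  have cont: "continuous_on UNIV b"
    using diff by (meson differentiable_imp_continuous_within continuous_at_imp_continuous_on)
  have M1: "loc_max (S b) (M 1)" and M2: "loc_max (S b) (M 2)" using maxima by blast+
  have m1: "loc_min (S b) (m 1)" and m2: "loc_min (S b) (m 2)" using minima by blast+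
  have zeros: "b (M 1) = 0" "b (M 2) = 0" "b (m 1) = 0" "b (m 2) = 0"
    using zero_at_loc_max[OF cont] zero_at_loc_min[OF cont] M1 M2 m1 m2 by auto
  have only_zeros: "x = M 1 \<or> x = m 1 \<or> x = M 2 \<or> x = m 2" if "0 \<le> x" "x < 1" "b x = 0" for x
  proof -
    have "card {M 1, m 1, M 2, m 2} = 4" using order by simp
    moreover have "{M 1, m 1, M 2, m 2} \<subseteq> {\<theta> \<in> {0..<1}. b \<theta> = 0}" using zeros order by auto
    moreover have "finite {\<theta> \<in> {0..<1}. b \<theta> = 0}" using four_zeros by (simp add: card_ge_0_finite)
    ultimately have "{M 1, m 1, M 2, m 2} = {\<theta> \<in> {0..<1}. b \<theta> = 0}"
      using four_zeros by (intro card_subset_eq) auto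
    then show ?thesis using that by auto
  qed
  have no_zero_last: "b x \<noteq> 0" if "m 2 < x" "x < M 3" for x
  proof
    assume "b x = 0"
    consider "x < 1" | "1 \<le> x" by linarith
    then show False
    proof cases
      case 1
      then show ?thesis using only_zeros[of x] \<open>b x = 0\<close> that order by force
    next
      case 2
      then show ?thesis
        using only_zeros[of "x - 1"] \<open>b x = 0\<close> that order M3 periodic[of "x - 1"] by force
    qed
  qed
  have no_zero: "b x \<noteq> 0"
    if "M 1 < x \<and> x < m 1 \<or> m 1 < x \<and> x < M 2 \<or> M 2 < x \<and> x < m 2" for x
    using only_zeros[of x] that order by force
  have s1: "0 < b x" if "M 1 < x" "x < m 1" for x
    by (rule pos_right_of_loc_max[OF cont M1 _ that]) (use no_zero in blast)
  have s2: "b x < 0" if "m 1 < x" "x < M 2" for x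
    by (rule neg_right_of_loc_min[OF cont m1 _ that]) (use no_zero in blast)
  have s3: "0 < b x" if "M 2 < x" "x < m 2" for x
    by (rule pos_right_of_loc_max[OF cont M2 _ that]) (use no_zero in blast)
  have s4: "b x < 0" if "m 2 < x" "x < M 3" for x
    by (rule neg_right_of_loc_min[OF cont m2 _ that]) (use no_zero_last in blast)
  have dM: "0 < deriv b (M 1)" "0 < deriv b (M 2)"
    using deriv_pos_if_pos_right[OF diff, of "M 1" "m 1"] deriv_pos_if_pos_right[OF diff, of "M 2" "m 2"]
      zeros nondegenerate order s1 s3 by auto
  have dm: "deriv b (m 1) < 0" "deriv b (m 2) < 0"
    using deriv_neg_if_neg_right[OF diff, of "m 1" "M 2"] deriv_neg_if_neg_right[OF diff, of "m 2" "M 3"]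
      zeros nondegenerate order M3 s2 s4 by auto
  \<comment> \<open>The point \<open>M 3\<close> lies outside the fundamental domain and inherits its data from \<open>M 1\<close>.\<close>
  have "b (M 3) = 0" using zeros periodic[of "M 1"] M3 by (simp add: add.commute)
  have "(b has_real_derivative deriv b (M 1)) (at (M 1))"
    using diff by (simp add: DERIV_deriv_iff_real_differentiable)
  then have "(b has_real_derivative deriv b (M 1)) (at (M 3))"
    using DERIV_shift[of b "deriv b (M 1)" "M 1" 1] M3 by (simp add: periodic add.commute)
  then have dM3: "0 < deriv b (M 3)" using dM(1) by (simp add: DERIV_imp_deriv)

  have shift: "S b (y + 1) = S b y - (S b (M 1) - S b (M 3))" for y
    using S_shift[OF cont periodic, of y "M 1"] M3 by (simp add: add.commute)
  then have shift_less: "S b (y + 1) < S b y" for y using heights by simp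
  note dec = S_decreasing_if_pos[OF cont] and inc = S_increasing_if_neg[OF cont]
  have from_M2: "S b y < S b (M 2)" if "M 2 < y" "y \<le> M 3" for y
  proof (cases "y \<le> m 2")
    case True
    then show ?thesis using dec[of "M 2" y] s3 that by simp
  next
    case False
    then have "S b y \<le> S b (M 3)" using inc[of y "M 3"] s4 that by (cases "y = M 3") auto
    then show ?thesis using heights by simp
  qed
  have to_M2: "S b y < S b (M 1)" if "M 1 < y" "y \<le> M 2" for y
  proof (cases "y \<le> m 1")
    case True
    then show ?thesis using dec[of "M 1" y] s1 that by simp
  next
    case False
    then have "S b y \<le> S b (M 2)" using inc[of y "M 2"] s2 that by (cases "y = M 2") auto
    then show ?thesis using heights by simp
  qed
  have right_M1: "S b y < S b (M 1)" if "M 1 < y" for y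
  proof (rule below_beyond_one_period[where f = "S b", OF _ _ that])
    show "S b (y + 1) < S b y" for y by (rule shift_less)
    show "S b y < S b (M 1)" if "M 1 < y" "y \<le> M 1 + 1" for y
      using to_M2[of y] from_M2[of y] heights that M3 by (cases "y \<le> M 2") auto
  qed
  have right_M3: "S b y < S b (M 3)" if "M 3 < y" for y
    using right_M1[of "y - 1"] shift[of "y - 1"] that M3 by simp
  have right_M2: "S b y < S b (M 2)" if "M 2 < y" for y
    using from_M2[of y] right_M3[of y] heights that by (cases "y \<le> M 3") auto

  interpret W1: potential_well b "M 1" "m 1" "M 2"
    by unfold_locales (use cont diff zeros dM dm s1 s2 heights order right_M2 in auto)
  interpret W2: potential_well b "M 2" "m 2" "M 3"
    by unfold_locales
      (use cont diff zeros \<open>b (M 3) = 0\<close> dM3 dm s3 s4 heights order M3 right_M3 in auto)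

  define Z where "Z = Z_weight b M m"
  have Z_eq: "Z = sigma_weight b (m 1) * omega_weight b (M 2) + sigma_weight b (m 2) * omega_weight b (M 3)"
    by (simp add: Z_def Z_weight_def numeral_3_eq_3 numeral_2_eq_2)
  have Z_pos: "0 < Z"
    unfolding Z_eq using W1.omega_pos W1.sigma_pos W2.omega_pos W2.sigma_pos by (intro add_pos_pos mult_pos_pos)
  have H: "S b (M 2) - S b (m 1) = H" "S b (M 3) - S b (m 2) = H"
    using depths W1.Vhat_valley[of "m 1"] W2.Vhat_valley[of "m 2"] W1.foot_props W2.foot_props
      W1.m_M W2.m_M by auto
  have "((\<lambda>\<epsilon>. integral {M 1..M 2} (pi_eps b \<epsilon>) / (\<epsilon> * exp (H / \<epsilon>))
      + integral {M 2..M 3} (pi_eps b \<epsilon>) / (\<epsilon> * exp (H / \<epsilon>))) \<longlongrightarrow> Z) (at_right 0)"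
    unfolding Z_eq using tendsto_add[OF W1.mass_asymptotics W2.mass_asymptotics] by (simp only: H)
  moreover have "\<forall>\<^sub>F \<epsilon> in at_right 0. integral {M 1..M 2} (pi_eps b \<epsilon>) / (\<epsilon> * exp (H / \<epsilon>))
      + integral {M 2..M 3} (pi_eps b \<epsilon>) / (\<epsilon> * exp (H / \<epsilon>)) = c_eps b \<epsilon> / (\<epsilon> * exp (H / \<epsilon>))"
    using eventually_at_right_less[of 0]
  proof eventually_elim
    case (elim \<epsilon>)
    have "integral {M 1..M 2} (pi_eps b \<epsilon>) + integral {M 2..M 3} (pi_eps b \<epsilon>)
        = integral {M 1..M 3} (pi_eps b \<epsilon>)"
      using order M3 elim
      by (intro Henstock_Kurzweil_Integration.integral_combine W1.pi_eps_integrable) auto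
    also have "\<dots> = c_eps b \<epsilon>"
      using c_eps_shift[OF cont periodic elim, of "M 1"] order M3 by (simp add: add.commute)
    finally show ?case by (simp add: add_divide_distrib[symmetric])
  qed
  ultimately have partition: "((\<lambda>\<epsilon>. c_eps b \<epsilon> / (\<epsilon> * exp (H / \<epsilon>))) \<longlongrightarrow> Z) (at_right 0)"
    by (rule Lim_transform_eventually)

  have three: "2 + 1 = (3::nat)" "1 + 1 = (2::nat)" by simp_all
  have foot1: "ell b M 1 = W1.foot" by (simp only: ell_def W1.foot_def three)
  have foot2: "ell b M 2 = W2.foot" by (simp only: ell_def W2.foot_def three)
  \<comment> \<open>The valleys lie on different sides of \<open>M 2\<close>, which selects the weight that applies at \<open>x\<close>.\<close>
  define r where "r \<epsilon> x = prefactor b H \<epsilon> x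
    / (omega_weight b (if x < M 2 then M 2 else M 3) / (Z * sqrt \<epsilon>)) - 1" for \<epsilon> x
  define r' where "r' \<epsilon> x = prefactor b H \<epsilon> x * (Z * b x) - 1" for \<epsilon> x
  have valley1: "valley b M 1 = {W1.foot<..<M 2}" and valley2: "valley b M 2 = {W2.foot<..<M 3}"
    by (simp_all only: valley_def foot1 foot2 three)
  have in_valley2: "\<not> x < M 2" if "W2.foot < x" for x using that W2.foot_props by simp
  have unif: "uniform_limit (\<Union>i\<in>{1, 2}. {x \<in> valley b M i. x < M (i + 1) - \<delta>}) r (\<lambda>_. 0) (at_right 0)"
    if "0 < \<delta>" for \<delta>
  proof -
    have "uniform_limit {x. W1.foot < x \<and> x < M 2 - \<delta>} r (\<lambda>_. 0) (at_right 0)"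
      by (rule uniform_limit_cong'[THEN iffD1, OF _ _ W1.prefactor_valley[OF partition Z_pos that]])
        (use that in \<open>auto simp: r_def\<close>)
    moreover have "uniform_limit {x. W2.foot < x \<and> x < M 3 - \<delta>} r (\<lambda>_. 0) (at_right 0)"
      by (rule uniform_limit_cong'[THEN iffD1, OF _ _ W2.prefactor_valley[OF partition Z_pos that]])
        (use in_valley2 in \<open>auto simp: r_def\<close>)
    ultimately have "uniform_limit ({x. W1.foot < x \<and> x < M 2 - \<delta>} \<union> {x. W2.foot < x \<and> x < M 3 - \<delta>})
        r (\<lambda>_. 0) (at_right 0)"
      by (rule uniform_limit_on_Un)
    then show ?thesis
      by (rule uniform_limit_on_subset) (auto simp: valley1 valley2 three simp del: One_nat_def)
  qed
  have eq: "prefactor b H \<epsilon> x = (1 + r \<epsilon> x) * (omega_weight b (M (i + 1)) / (Z * sqrt \<epsilon>))"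
    if "i \<in> {1, 2}" "0 < \<epsilon>" "x \<in> valley b M i" for i \<epsilon> x
    using that in_valley2[of x] W1.omega_pos W2.omega_pos Z_pos
    by (auto simp: r_def valley1 valley2 three simp del: One_nat_def)
  have eq': "prefactor b H \<epsilon> x = (1 + r' \<epsilon> x) * (1 / (Z * b x))"
    if "i \<in> {1, 2}" "x \<in> saddle_interval b M i" for i \<epsilon> x
  proof -
    have "b x \<noteq> 0"
      using that s1[of x] s3[of x] W1.foot_props W2.foot_props
      by (auto simp: saddle_interval_def foot1 foot2 simp del: One_nat_def)
    then show ?thesis using Z_pos by (simp add: r'_def)
  qed
  have lim': "((\<lambda>\<epsilon>. r' \<epsilon> x) \<longlongrightarrow> 0) (at_right 0)"
    if "x \<in> saddle_interval b M 1 \<union> saddle_interval b M 2" for x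
    using that W1.prefactor_saddle[OF partition Z_pos, of x] W2.prefactor_saddle[OF partition Z_pos, of x]
    by (auto simp: r'_def saddle_interval_def foot1 foot2 simp del: One_nat_def)
  show ?thesis
    unfolding Z_def[symmetric]
  proof (intro conjI exI ballI allI impI)
    show "prefactor b H \<epsilon> x = (1 + r \<epsilon> x) * (omega_weight b (M (i + 1)) / (Z * sqrt \<epsilon>))"
      if "i \<in> {1, 2}" "0 < \<epsilon>" "x \<in> valley b M i" for i \<epsilon> x
      using that by (rule eq)
    show "uniform_limit (\<Union>i\<in>{1, 2}. {x \<in> valley b M i. x < M (i + 1) - \<delta>}) r (\<lambda>_. 0) (at_right 0)"
      if "0 < \<delta>" for \<delta>
      using that by (rule unif)
    show "prefactor b H \<epsilon> x = (1 + r' \<epsilon> x) * (1 / (Z * b x))"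
      if "i \<in> {1, 2}" "x \<in> saddle_interval b M i" for i \<epsilon> x
      using that by (rule eq')
    show "((\<lambda>\<epsilon>. r' \<epsilon> x) \<longlongrightarrow> 0) (at_right 0)"
      if "x \<in> saddle_interval b M 1 \<union> saddle_interval b M 2" for x
      using that by (rule lim')
  qed
qed

end
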